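(* If $((S,d),\phi)$ is a flow of $\mathcal L_{qm}$ and $k\in\mathbb N$, then $k\cdot\widetilde h(\phi)\le\widetilde h(\phi^k)$.
   Context: A generalized quasimetric on a non-empty set $S$ is a function $d\colon S\times S\to\mathbb R_{\ge0}\cup\{\infty\}$ with (QM1) $d(x,y)=d(y,x)=0$ if and only if $x=y$, and (QM2) $d(x,z)\le d(x,y)+d(y,z)$ for all $x,y,z$. It induces the partial order $x\le y\iff d(y,x)=0$. The category $\mathcal L_{qm}$ has as objects the pairs $(S,d)$ such that $d$ is a generalized quasimetric, $(S,\le)$ is a join-semilattice (join written $+$) with bottom element $0$, and (QM3) $d(x,y)=d(x,x+y)$ for all $x,y$; its morphisms are the maps $\phi\colon (S,d)\to(S',d')$ with $\phi(x+y)=\phi(x)+\phi(y)$, $\phi(0)=0$ and $d'(\phi(x),\phi(y))\le d(x,y)$ for all $x,y$. A flow of $\mathcal L_{qm}$ is a pair $((S,d),\phi)$ with $(S,d)\in\mathcal L_{qm}$ and $\phi\colon(S,d)\to(S,d)$ an endomorphism in $\mathcal L_{qm}$. For a flow $((S,d),\phi)$ of $\mathcal L_{qm}$, $x\in S$ is $\phi$-inert if $d(x,\phi(x))<\infty$; $\mathcal I_\phi(S)$ is the set of $\phi$-inert elements; $T_n(\phi,x)=x+\phi(x)+\dots+\phi^{n-1}(x)$ for $n\ge1$. For $x\in\mathcal I_\phi(S)$ put $\widetilde h(\phi,x)=\lim_{n\to\infty}\frac{d(x,T_n(\phi,x))}{n}$ (this limit exists), and $\widetilde h(\phi)=\sup\{\widetilde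 h(\phi,x)\mid x\in\mathcal I_\phi(S)\}\in\mathbb R_{\ge0}\cup\{\infty\}$. $\mathbb N$ contains $0$; $\phi^0$ is the identity; $0\cdot\infty=0$. *)

theory Defs
  imports "HOL-Analysis.Analysis" "HOL-Algebra.Lattice"
begin

locale generalized_quasimetric =
  fixes S :: "'a set" and d :: "'a \<Rightarrow> 'a \<Rightarrow> ennreal"
  assumes nonempty: "S \<noteq> {}"
    and QM1: "\<lbrakk>x \<in> S; y \<in> S\<rbrakk> \<Longrightarrow> (d x y = 0 \<and> d y x = 0) \<longleftrightarrow> x = y"
    and QM2: "\<lbrakk>x \<in> S; y \<in> S; z \<in> S\<rbrakk> \<Longrightarrow> d x z \<le> d x y + d y z"

text \<open>Note the direction of the induced order: \<open>x\<close> is below \<open>y\<close> when the distance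
  from \<open>y\<close> to \<open>x\<close> vanishes.  Joins and bottom below are the ones of this order.\<close>

definition qm_order :: "'a set \<Rightarrow> ('a \<Rightarrow> 'a \<Rightarrow> ennreal) \<Rightarrow> 'a gorder" where
  "qm_order S d = \<lparr>carrier = S, eq = (=), le = (\<lambda>x y. d y x = 0)\<rparr>"

abbreviation qm_join :: "'a set \<Rightarrow> ('a \<Rightarrow> 'a \<Rightarrow> ennreal) \<Rightarrow> 'a \<Rightarrow> 'a \<Rightarrow> 'a" where
  "qm_join S d x y \<equiv> x \<squnion>\<^bsub>qm_order S d\<^esub> y"

abbreviation qm_bottom :: "'a set \<Rightarrow> ('a \<Rightarrow> 'a \<Rightarrow> ennreal) \<Rightarrow> 'a" where
  "qm_bottom S d \<equiv> \<bottom>\<^bsub>qm_order S d\<^esub>"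

locale Lqm_object = generalized_quasimetric S d
  for S :: "'a set" and d :: "'a \<Rightarrow> 'a \<Rightarrow> ennreal" +
  assumes join_semilattice: "upper_semilattice (qm_order S d)"
    and bottom: "weak_partial_order_bottom (qm_order S d)"
    and QM3: "\<lbrakk>x \<in> S; y \<in> S\<rbrakk> \<Longrightarrow> d x y = d x (qm_join S d x y)"

locale Lqm_morphism = dom: Lqm_object S d + cod: Lqm_object S' d'
  for S :: "'a set" and d :: "'a \<Rightarrow> 'a \<Rightarrow> ennreal"
    and S' :: "'b set" and d' :: "'b \<Rightarrow> 'b \<Rightarrow> ennreal" +
  fixes \<phi> :: "'a \<Rightarrow> 'b"
  assumes maps: "\<phi> \<in> S \<rightarrow> S'"
    and map_join: "\<lbrakk>x \<in> S; y \<in> S\<rbrakk> \<Longrightarrow> \<phi> (qm_join S d x y) = qm_join S' d' (\<phi> x) (\<phi> y)"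
    and map_bottom: "\<phi> (qm_bottom S d) = qm_bottom S' d'"
    and contractive: "\<lbrakk>x \<in> S; y \<in> S\<rbrakk> \<Longrightarrow> d' (\<phi> x) (\<phi> y) \<le> d x y"

locale Lqm_flow = Lqm_morphism S d S d \<phi>
  for S :: "'a set" and d :: "'a \<Rightarrow> 'a \<Rightarrow> ennreal" and \<phi> :: "'a \<Rightarrow> 'a"

definition inert :: "'a set \<Rightarrow> ('a \<Rightarrow> 'a \<Rightarrow> ennreal) \<Rightarrow> ('a \<Rightarrow> 'a) \<Rightarrow> 'a set" where
  "inert S d \<phi> = {x \<in> S. d x (\<phi> x) < \<infinity>}"

text \<open>The trajectory \<open>x + \<phi> x + \<dots> + \<phi>\<^sup>n\<^sup>-\<^sup>1 x\<close>, with the empty join (bottom) at \<open>n = 0\<close>.\<close>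

primrec trajectory ::
    "'a set \<Rightarrow> ('a \<Rightarrow> 'a \<Rightarrow> ennreal) \<Rightarrow> ('a \<Rightarrow> 'a) \<Rightarrow> 'a \<Rightarrow> nat \<Rightarrow> 'a" where
  "trajectory S d \<phi> x 0 = qm_bottom S d"
| "trajectory S d \<phi> x (Suc n) = qm_join S d (trajectory S d \<phi> x n) ((\<phi> ^^ n) x)"

text \<open>The term at \<open>n = 0\<close> is junk (a division by zero) and does not affect the limit.\<close>

definition local_entropy ::
    "'a set \<Rightarrow> ('a \<Rightarrow> 'a \<Rightarrow> ennreal) \<Rightarrow> ('a \<Rightarrow> 'a) \<Rightarrow> 'a \<Rightarrow> ennreal" where
  "local_entropy S d \<phi> x = lim (\<lambda>n. d x (trajectory S d \<phi> x n) / of_nat n)"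

definition entropy :: "'a set \<Rightarrow> ('a \<Rightarrow> 'a \<Rightarrow> ennreal) \<Rightarrow> ('a \<Rightarrow> 'a) \<Rightarrow> ennreal" where
  "entropy S d \<phi> = (SUP x \<in> inert S d \<phi>. local_entropy S d \<phi> x)"

end

theory Submission
  imports Defs
begin

text \<open>
  Write \<open>T x n\<close> for the trajectory and let \<open>x\<close> be \<open>\<phi>\<close>-inert.  For \<open>k > 0\<close> the point
  \<open>y = T x k\<close> is inert for \<open>\<phi> ^^ k\<close> (\<open>block_inert\<close>), and the trajectory of \<open>y\<close> of
  length \<open>n\<close> under \<open>\<phi> ^^ k\<close> lies above \<open>T x (k * n)\<close>.  Hence the distance from \<open>x\<close> to
  \<open>T x (k * n)\<close> exceeds the distance from \<open>y\<close> to that trajectory by at most the finite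
  constant \<open>d x y\<close>.  Dividing by \<open>n\<close> makes the constant disappear, and in the limit the
  local entropy of \<open>y\<close> under \<open>\<phi> ^^ k\<close> is at least \<open>k\<close> times that of \<open>x\<close> under \<open>\<phi>\<close>
  (\<open>local_entropy_block\<close>); then take suprema.

  Passing to the limit requires the sequences that define local entropy to converge
  (\<open>local_entropy_limit\<close>).  This is Fekete's lemma for the shifted sequence
  \<open>n \<mapsto> d x (T x (Suc n))\<close>, whose subadditivity comes from (QM3): once \<open>T x (Suc m)\<close> is
  reached, the remaining distance to the next \<open>n\<close> orbit points is at most the distance from
  \<open>(\<phi> ^^ m) x\<close>, which lies below \<open>T x (Suc m)\<close>, to its own trajectory.

  A trajectory is the least upper bound of its orbit points, so that one trajectory is
  shown to lie below another one orbit point at a time.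
\<close>

section \<open>Subadditive sequences\<close>

lemma subadditive_division_bound:
  fixes b :: "nat \<Rightarrow> real"
  assumes "\<And>m n. b (m + n) \<le> b m + b n"
  shows "b (q * m + r) \<le> of_nat q * b m + b r"
proof (induction q)
  case (Suc q)
  have "b (Suc q * m + r) = b (m + (q * m + r))" by (simp add: add.assoc)
  also have "\<dots> \<le> b m + b (q * m + r)" by (rule assms)
  finally show ?case using Suc by (simp add: algebra_simps)
qed simp

text \<open>Fekete's lemma.  The infimum bounds all quotients from below.  If the quotient at
  \<open>m\<close> is below \<open>a\<close>, division with remainder by \<open>m\<close> bounds the quotient at \<open>n\<close> by the one
  at \<open>m\<close> plus \<open>B / n\<close>, where \<open>B\<close> bounds \<open>b\<close> on all possible remainders.\<close>

lemma fekete_nonneg: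
  fixes b :: "nat \<Rightarrow> real"
  assumes sub: "\<And>m n. b (m + n) \<le> b m + b n" and nonneg: "\<And>n. 0 \<le> b n"
  shows "(\<lambda>n. b n / of_nat n) \<longlonglongrightarrow> (INF n\<in>{1..}. b n / of_nat n)" (is "_ \<longlonglongrightarrow> ?L")
proof (rule order_tendstoI)
  have bdd: "bdd_below ((\<lambda>n. b n / of_nat n) ` {1..})"
    by (rule bdd_belowI[of _ 0]) (auto simp: nonneg)
  fix a
  show "\<forall>\<^sub>F n in sequentially. a < b n / of_nat n" if "a < ?L"
    using eventually_ge_at_top[of 1]
  proof eventually_elim
    case (elim n)
    have "?L \<le> b n / of_nat n" using elim by (intro cINF_lower bdd) auto
    with that show ?case by simp
  qed
  show "\<forall>\<^sub>F n in sequentially. b n / of_nat n < a" if "?L < a"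
  proof -
    obtain m where m: "1 \<le> m" "b m / of_nat m < a"
      using \<open>?L < a\<close> cINF_less_iff[OF _ bdd, of a] by auto
    define B where "B = (\<Sum>r<m. b r)"
    have bound: "b n / of_nat n \<le> b m / of_nat m + B / of_nat n" if "1 \<le> n" for n
    proof -
      have "b n = b (n div m * m + n mod m)" by simp
      also have "\<dots> \<le> of_nat (n div m) * b m + b (n mod m)"
        by (rule subadditive_division_bound) (rule sub)
      also have "b (n mod m) \<le> B"
        unfolding B_def using m nonneg by (intro member_le_sum) auto
      also have "real (n div m) \<le> real n / real m"
        by (rule of_nat_div_le_of_nat)
      finally have "b n \<le> real n / real m * b m + B"
        using nonneg[of m] by (simp add: mult_right_mono)
      then show ?thesis using that m by (simp add: field_simps)
    qed
    have "(\<lambda>n. b m / of_nat m + B / of_nat n) \<longlonglongrightarrow> b m / of_nat m + 0"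
      by (intro tendsto_add tendsto_const lim_const_over_n)
    then have "\<forall>\<^sub>F n in sequentially. b m / of_nat m + B / of_nat n < a"
      using m by (intro order_tendstoD(2)) auto
    then show ?thesis
      using eventually_ge_at_top[of 1]
      by eventually_elim (use bound in fastforce)
  qed
qed

section \<open>Joins and distances\<close>

context Lqm_object
begin

lemma dist_self: "x \<in> S \<Longrightarrow> d x x = 0"
  using QM1 by blast

lemma
  assumes "x \<in> S" "y \<in> S"
  shows join_mem: "qm_join S d x y \<in> S"
    and join_upper_left: "d (qm_join S d x y) x = 0"
    and join_upper_right: "d (qm_join S d x y) y = 0"
proof -
  interpret J: upper_semilattice "qm_order S d" by (rule join_semilattice)
  show "qm_join S d x y \<in> S" "d (qm_join S d x y) x = 0" "d (qm_join S d x y) y = 0"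
    using J.join_closed[of x y] J.join_left[of x y] J.join_right[of x y] assms
    by (simp_all add: qm_order_def)
qed

lemma join_least:
  assumes "x \<in> S" "y \<in> S" "z \<in> S" "d z x = 0" "d z y = 0"
  shows "d z (qm_join S d x y) = 0"
proof -
  interpret J: upper_semilattice "qm_order S d" by (rule join_semilattice)
  show ?thesis using J.join_le[of x z y] assms by (simp add: qm_order_def)
qed

lemma
  shows bottom_mem: "qm_bottom S d \<in> S"
    and bottom_least: "z \<in> S \<Longrightarrow> d z (qm_bottom S d) = 0"
proof -
  interpret B: weak_partial_order_bottom "qm_order S d" by (rule bottom)
  show "qm_bottom S d \<in> S" "z \<in> S \<Longrightarrow> d z (qm_bottom S d) = 0"
    using B.bottom_closed B.bottom_lower[of z] by (simp_all add: qm_order_def)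
qed

text \<open>Since \<open>x\<close> is below \<open>y\<close> when \<open>d y x = 0\<close>, the triangle inequality makes the
  distance antitone in its first argument and monotone in its second.\<close>

lemma dist_antimono_left:
  "\<lbrakk>x \<in> S; y \<in> S; z \<in> S; d y x = 0\<rbrakk> \<Longrightarrow> d y z \<le> d x z"
  using QM2[of y x z] by simp

lemma dist_mono_right:
  "\<lbrakk>x \<in> S; y \<in> S; z \<in> S; d z y = 0\<rbrakk> \<Longrightarrow> d x y \<le> d x z"
  using QM2[of x z y] by simp

text \<open>Go from \<open>x\<close> to \<open>y\<close> and from there to \<open>y + z\<close>; by (QM3) the second step has length
  \<open>d y z\<close>.\<close>

lemma dist_join_le:
  assumes "x \<in> S" "y \<in> S" "z \<in> S"
  shows "d x (qm_join S d y z) \<le> d x y + d y z"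
  using QM2[of x y "qm_join S d y z"] QM3[of y z] assms by (simp add: join_mem)

end

section \<open>Trajectories\<close>

context Lqm_flow
begin

abbreviation T :: "'a \<Rightarrow> nat \<Rightarrow> 'a" where
  "T \<equiv> trajectory S d \<phi>"

lemma iterate_mem: "x \<in> S \<Longrightarrow> (\<phi> ^^ n) x \<in> S"
  using maps by (induction n) auto

lemma iterate_contractive:
  "\<lbrakk>x \<in> S; y \<in> S\<rbrakk> \<Longrightarrow> d ((\<phi> ^^ n) x) ((\<phi> ^^ n) y) \<le> d x y"
proof (induction n)
  case (Suc n)
  then show ?case
    using contractive[of "(\<phi> ^^ n) x" "(\<phi> ^^ n) y"] by (auto simp: iterate_mem intro: order_trans)
qed simp

lemma iterate_mono: "\<lbrakk>x \<in> S; y \<in> S; d y x = 0\<rbrakk> \<Longrightarrow> d ((\<phi> ^^ n) y) ((\<phi> ^^ n) x) = 0"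
  using iterate_contractive[of y x n] by simp

lemma flow_iterate: "Lqm_flow S d (\<phi> ^^ n)"
proof
  show "(\<phi> ^^ n) \<in> S \<rightarrow> S" by (simp add: iterate_mem)
  show "(\<phi> ^^ n) (qm_join S d x y) = qm_join S d ((\<phi> ^^ n) x) ((\<phi> ^^ n) y)"
    if "x \<in> S" "y \<in> S" for x y
    using that by (induction n) (simp_all add: map_join iterate_mem)
  show "(\<phi> ^^ n) (qm_bottom S d) = qm_bottom S d"
    by (induction n) (simp_all add: map_bottom)
qed (rule iterate_contractive)

lemma trajectory_mem: "x \<in> S \<Longrightarrow> T x n \<in> S"
  by (induction n) (simp_all add: dom.bottom_mem dom.join_mem iterate_mem)

text \<open>The next two lemmas say that \<open>T x n\<close> is the least upper bound of the first \<open>n\<close>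
  points of the orbit.\<close>

lemma trajectory_upper:
  assumes "x \<in> S" "i < n"
  shows "d (T x n) ((\<phi> ^^ i) x) = 0"
  using \<open>i < n\<close>
proof (induction n)
  case (Suc n)
  show ?case
  proof (cases "i = n")
    case True
    then show ?thesis using assms by (simp add: dom.join_upper_right trajectory_mem iterate_mem)
  next
    case False
    with Suc have "d (T x n) ((\<phi> ^^ i) x) = 0" by simp
    moreover have "d (T x (Suc n)) (T x n) = 0"
      using assms by (simp add: dom.join_upper_left trajectory_mem iterate_mem)
    ultimately show ?thesis
      using dom.dist_antimono_left[of "T x n" "T x (Suc n)" "(\<phi> ^^ i) x"] assms
        trajectory_mem[of x "Suc n"]
      by (simp add: trajectory_mem iterate_mem)
  qed
qed simp

lemma trajectory_least:
  assumes "x \<in> S" "z \<in> S" "\<And>i. i < n \<Longrightarrow> d z ((\<phi> ^^ i) x) = 0"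
  shows "d z (T x n) = 0"
  using assms(3)
  by (induction n) (simp_all add: assms dom.bottom_least dom.join_least trajectory_mem iterate_mem)

lemma dist_trajectory_one:
  assumes "x \<in> S"
  shows "d x (T x (Suc 0)) = 0"
  by (rule trajectory_least) (use assms in \<open>auto simp: dom.dist_self\<close>)

text \<open>The shift by one is essential: it makes the blocks \<open>T x (Suc m)\<close> and
  \<open>(\<phi> ^^ m) (T x (Suc n))\<close> overlap in \<open>(\<phi> ^^ m) x\<close>.  The distance between them is then at
  most the distance from this common point to the second block, which is the image under
  \<open>\<phi> ^^ m\<close> of the pair \<open>x\<close>, \<open>T x (Suc n)\<close>.\<close>

lemma dist_trajectory_subadditive:
  assumes x: "x \<in> S"
  shows "d x (T x (Suc (m + n))) \<le> d x (T x (Suc m)) + d x (T x (Suc n))"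
proof -
  let ?u = "T x (Suc m)" and ?v = "(\<phi> ^^ m) (T x (Suc n))"
  have mem: "?u \<in> S" "?v \<in> S" "T x (Suc (m + n)) \<in> S" "qm_join S d ?u ?v \<in> S"
    by (intro trajectory_mem iterate_mem dom.join_mem x)+
  have "d (qm_join S d ?u ?v) (T x (Suc (m + n))) = 0"
  proof (rule trajectory_least)
    fix i assume i: "i < Suc (m + n)"
    have orbit: "(\<phi> ^^ i) x \<in> S" by (rule iterate_mem[OF x])
    show "d (qm_join S d ?u ?v) ((\<phi> ^^ i) x) = 0"
    proof (cases "i < Suc m")
      case True
      then have "d ?u ((\<phi> ^^ i) x) = 0" by (rule trajectory_upper[OF x])
      then show ?thesis
        using dom.dist_antimono_left[OF mem(1) mem(4) orbit] mem
        by (simp add: dom.join_upper_left del: trajectory.simps)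
    next
      case False
      with i have "i - m < Suc n" and split: "i = m + (i - m)" by auto
      then have "d (T x (Suc n)) ((\<phi> ^^ (i - m)) x) = 0" by (intro trajectory_upper x)
      then have "d ?v ((\<phi> ^^ m) ((\<phi> ^^ (i - m)) x)) = 0"
        by (intro iterate_mono trajectory_mem iterate_mem x)
      also have "(\<phi> ^^ m) ((\<phi> ^^ (i - m)) x) = (\<phi> ^^ i) x"
        using split by (metis funpow_add o_apply)
      finally show ?thesis
        using dom.dist_antimono_left[OF mem(2) mem(4) orbit] mem
        by (simp add: dom.join_upper_right del: trajectory.simps)
    qed
  qed (use x mem in auto)
  then have "d x (T x (Suc (m + n))) \<le> d x (qm_join S d ?u ?v)"
    by (intro dom.dist_mono_right x mem)
  also have "\<dots> \<le> d x ?u + d ?u ?v"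
    by (intro dom.dist_join_le x mem)
  also have "d ?u ?v \<le> d ((\<phi> ^^ m) x) ?v"
    by (intro dom.dist_antimono_left mem iterate_mem x trajectory_upper) simp
  also have "\<dots> \<le> d x (T x (Suc n))"
    by (intro iterate_contractive trajectory_mem x)
  finally show ?thesis by (simp add: add_left_mono del: trajectory.simps)
qed

text \<open>One step of \<open>\<phi> ^^ k\<close> moves the block \<open>T x k\<close> by its own length.  The orbit point with
  index \<open>i < k * n\<close> therefore lies below the block with index \<open>i div k\<close>, at position
  \<open>i mod k\<close>.\<close>

lemma trajectory_le_block_trajectory:
  assumes x: "x \<in> S"
  shows "d (trajectory S d (\<phi> ^^ k) (T x k) n) (T x (k * n)) = 0"
proof -
  interpret P: Lqm_flow S d "\<phi> ^^ k" by (rule flow_iterate)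
  let ?y = "T x k"
  have y: "?y \<in> S" by (rule trajectory_mem[OF x])
  show ?thesis
  proof (rule trajectory_least[OF x P.trajectory_mem[OF y]])
    fix i assume i: "i < k * n"
    then have k: "0 < k" by (cases k) auto
    let ?q = "i div k" and ?r = "i mod k"
    have "?q < n" using i by (simp add: less_mult_imp_div_less mult.commute)
    then have 1: "d (P.T ?y n) (((\<phi> ^^ k) ^^ ?q) ?y) = 0" by (rule P.trajectory_upper[OF y])
    have "d ?y ((\<phi> ^^ ?r) x) = 0" using k by (intro trajectory_upper x) simp
    then have "d (((\<phi> ^^ k) ^^ ?q) ?y) (((\<phi> ^^ k) ^^ ?q) ((\<phi> ^^ ?r) x)) = 0"
      by (intro P.iterate_mono y iterate_mem x)
    also have "((\<phi> ^^ k) ^^ ?q) ((\<phi> ^^ ?r) x) = (\<phi> ^^ (k * ?q + ?r)) x"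
      by (simp only: funpow_add o_apply funpow_mult)
    finally have "d (((\<phi> ^^ k) ^^ ?q) ?y) ((\<phi> ^^ i) x) = 0" by simp
    then show "d (P.T ?y n) ((\<phi> ^^ i) x) = 0"
      using dom.dist_antimono_left[OF P.iterate_mem[OF y] P.trajectory_mem[OF y]
          iterate_mem[OF x, of i] 1]
      by simp
  qed
qed

section \<open>Inert points and local entropy\<close>

lemma inert_mem: "x \<in> inert S d \<phi> \<Longrightarrow> x \<in> S"
  by (simp add: inert_def)

lemma dist_iterate_finite:
  assumes "x \<in> inert S d \<phi>"
  shows "d x ((\<phi> ^^ n) x) < \<infinity>"
proof (induction n)
  case 0
  then show ?case using assms by (simp add: inert_mem dom.dist_self)
next
  case (Suc n)
  have x: "x \<in> S" and fin: "d x (\<phi> x) < \<infinity>" using assms by (auto simp: inert_def)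
  have "d x ((\<phi> ^^ Suc n) x) \<le> d x (\<phi> x) + d (\<phi> x) ((\<phi> ^^ Suc n) x)"
    using maps x by (intro dom.QM2 iterate_mem) auto
  also have "d (\<phi> x) ((\<phi> ^^ Suc n) x) \<le> d x ((\<phi> ^^ n) x)"
    using contractive[OF x iterate_mem[OF x]] by simp
  finally show ?case
    using fin Suc by (simp add: add_left_mono) (meson ennreal_add_less_top le_less_trans)
qed

text \<open>Each further orbit point adds at most its distance from \<open>x\<close>, because \<open>x\<close> lies below
  every trajectory of positive length.\<close>

lemma dist_trajectory_finite:
  assumes "x \<in> inert S d \<phi>"
  shows "d x (T x n) < \<infinity>"
proof (induction n)
  case 0
  show ?case using assms by (simp add: inert_mem dom.bottom_least)
next
  case (Suc n)
  have x: "x \<in> S" using assms by (rule inert_mem)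
  show ?case
  proof (cases "n = 0")
    case True
    then show ?thesis using dist_trajectory_one[OF x] by simp
  next
    case False
    have "d (T x n) ((\<phi> ^^ n) x) \<le> d x ((\<phi> ^^ n) x)"
      using trajectory_upper[OF x, of 0 n] False x
      by (intro dom.dist_antimono_left trajectory_mem iterate_mem) auto
    then have "d (T x n) ((\<phi> ^^ n) x) < \<infinity>"
      using dist_iterate_finite[OF assms] by (rule le_less_trans)
    moreover have "d x (T x (Suc n)) \<le> d x (T x n) + d (T x n) ((\<phi> ^^ n) x)"
      using dom.dist_join_le[OF x trajectory_mem[OF x] iterate_mem[OF x]] by simp
    ultimately show ?thesis
      using Suc by (metis ennreal_add_eq_top infinity_ennreal_def less_top top.extremum_unique)
  qed
qed

text \<open>At inert points all distances involved are finite, so the limit can be taken in the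
  reals, where Fekete's lemma applies.\<close>

lemma local_entropy_limit:
  assumes "x \<in> inert S d \<phi>"
  obtains L where "local_entropy S d \<phi> x = ennreal L"
    and "(\<lambda>n. enn2real (d x (T x n)) / of_nat n) \<longlonglongrightarrow> L"
proof -
  have x: "x \<in> S" using assms by (rule inert_mem)
  define a where "a n = enn2real (d x (T x n))" for n
  have a: "d x (T x n) = ennreal (a n)" for n
    using dist_trajectory_finite[OF assms] by (simp add: a_def)
  have nonneg: "0 \<le> a n" for n by (simp add: a_def)
  define L where "L = (INF n\<in>{1..}. a (Suc n) / of_nat n)"
  have "a (Suc (m + n)) \<le> a (Suc m) + a (Suc n)" for m n
    using dist_trajectory_subadditive[OF x, of m n] nonneg
    by (simp add: a ennreal_le_iff flip: ennreal_plus del: trajectory.simps)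
  then have "(\<lambda>n. a (Suc n) / of_nat n) \<longlonglongrightarrow> L"
    unfolding L_def by (intro fekete_nonneg nonneg)
  then have "(\<lambda>n. a (Suc n) / of_nat n * (of_nat n / of_nat (Suc n))) \<longlonglongrightarrow> L * 1"
    by (intro tendsto_mult LIMSEQ_n_over_Suc_n)
  moreover have "\<forall>\<^sub>F n in sequentially.
      a (Suc n) / of_nat n * (of_nat n / of_nat (Suc n)) = a (Suc n) / of_nat (Suc n)"
    using eventually_gt_at_top[of 0] by eventually_elim simp
  \<comment> \<open>Fekete's quotients are shifted against the ones wanted here; the correction factor
    \<open>n / Suc n\<close> tends to 1.\<close>
  ultimately have "(\<lambda>n. a (Suc n) / of_nat (Suc n)) \<longlonglongrightarrow> L"
    unfolding mult_1_right by (rule Lim_transform_eventually)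
  then have lim: "(\<lambda>n. a n / of_nat n) \<longlonglongrightarrow> L"
    by (rule LIMSEQ_imp_Suc)
  have "(\<lambda>n. ennreal (a n / of_nat n)) \<longlonglongrightarrow> ennreal L"
    using lim by (rule tendsto_ennrealI)
  moreover have "\<forall>\<^sub>F n in sequentially. ennreal (a n / of_nat n) = d x (T x n) / of_nat n"
    using eventually_gt_at_top[of 0]
    by eventually_elim (simp add: a ennreal_of_nat_eq_real_of_nat divide_ennreal nonneg)
  ultimately have "(\<lambda>n. d x (T x n) / of_nat n) \<longlonglongrightarrow> ennreal L"
    by (rule Lim_transform_eventually)
  then have "local_entropy S d \<phi> x = ennreal L"
    unfolding local_entropy_def by (rule limI)
  then show thesis using lim unfolding a_def by (rule that)
qed

text \<open>With \<open>y = T x k\<close> and \<open>\<psi> = \<phi> ^^ k\<close>, the route \<open>x\<close>, \<open>\<psi> x\<close>, \<open>\<psi> y\<close> is finite, since its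
  second step is a contracted image of the step from \<open>x\<close> to \<open>y\<close>.  Starting from \<open>y\<close>, which
  lies above \<open>x\<close>, is no longer.\<close>

lemma block_inert:
  assumes "x \<in> inert S d \<phi>" "0 < k"
  shows "T x k \<in> inert S d (\<phi> ^^ k)"
proof -
  have x: "x \<in> S" using assms(1) by (rule inert_mem)
  let ?y = "T x k" and ?\<psi> = "\<phi> ^^ k"
  have y: "?y \<in> S" by (rule trajectory_mem[OF x])
  have "d ?y (?\<psi> ?y) \<le> d x (?\<psi> ?y)"
    using trajectory_upper[OF x assms(2)] by (intro dom.dist_antimono_left iterate_mem x y) simp
  also have "\<dots> \<le> d x (?\<psi> x) + d (?\<psi> x) (?\<psi> ?y)"
    by (intro dom.QM2 iterate_mem x y)
  also have "\<dots> \<le> d x (?\<psi> x) + d x ?y"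
    by (intro add_left_mono iterate_contractive x y)
  also have "\<dots> < \<infinity>"
    using dist_iterate_finite[OF assms(1)] dist_trajectory_finite[OF assms(1)] by simp
  finally show ?thesis using y by (simp add: inert_def)
qed

text \<open>Compare real sequences: the quotients for \<open>x\<close> along the multiples of \<open>k\<close>, and those for
  \<open>T x k\<close> under \<open>\<phi> ^^ k\<close>, with an error \<open>d x (T x k) / n\<close> that tends to 0.\<close>

lemma local_entropy_block:
  assumes inert: "x \<in> inert S d \<phi>" and k: "0 < k"
  shows "of_nat k * local_entropy S d \<phi> x \<le> local_entropy S d (\<phi> ^^ k) (T x k)"
proof -
  interpret P: Lqm_flow S d "\<phi> ^^ k" by (rule flow_iterate)
  let ?y = "T x k"
  have x: "x \<in> S" using inert by (rule inert_mem)
  have y: "?y \<in> S" by (rule trajectory_mem[OF x])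
  have inert_y: "?y \<in> inert S d (\<phi> ^^ k)" using inert k by (rule block_inert)
  define a where "a n = enn2real (d x (T x n))" for n
  define b where "b n = enn2real (d ?y (P.T ?y n))" for n
  obtain L where L: "local_entropy S d \<phi> x = ennreal L" "(\<lambda>n. a n / of_nat n) \<longlonglongrightarrow> L"
    unfolding a_def using inert by (rule local_entropy_limit)
  obtain M where M: "local_entropy S d (\<phi> ^^ k) ?y = ennreal M" "(\<lambda>n. b n / of_nat n) \<longlonglongrightarrow> M"
    unfolding b_def using inert_y by (rule P.local_entropy_limit)
  have le: "a (k * n) \<le> a k + b n" for n
  proof -
    have "d x (T x (k * n)) \<le> d x (P.T ?y n)"
      using trajectory_le_block_trajectory[OF x]
      by (intro dom.dist_mono_right x trajectory_mem P.trajectory_mem y)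
    also have "\<dots> \<le> d x ?y + d ?y (P.T ?y n)"
      by (intro dom.QM2 x y P.trajectory_mem)
    finally show ?thesis
      using dist_trajectory_finite[OF inert] P.dist_trajectory_finite[OF inert_y]
      unfolding a_def b_def
      by (subst enn2real_plus[symmetric]) (auto intro!: enn2real_mono)
  qed
  have "(\<lambda>n. of_nat k * (a (k * n) / of_nat (k * n))) \<longlonglongrightarrow> of_nat k * L"
    using LIMSEQ_subseq_LIMSEQ[OF L(2), of "\<lambda>n. k * n"] k
    by (intro tendsto_mult_left) (simp add: strict_mono_def o_def)
  moreover have "(\<lambda>n. a k / of_nat n + b n / of_nat n) \<longlonglongrightarrow> 0 + M"
    by (intro tendsto_add lim_const_over_n M)
  moreover have "of_nat k * (a (k * n) / of_nat (k * n)) \<le> a k / of_nat n + b n / of_nat n" for n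
    using le[of n] k by (simp add: divide_right_mono flip: add_divide_distrib)
  ultimately have "of_nat k * L \<le> M"
    by (intro LIMSEQ_le[of _ "of_nat k * L" _ M]) auto
  then show ?thesis
    by (simp add: L M ennreal_of_nat_eq_real_of_nat ennreal_leI flip: ennreal_mult')
qed

end

theorem corollary4p6:
  fixes S :: "'a set" and d :: "'a \<Rightarrow> 'a \<Rightarrow> ennreal" and \<phi> :: "'a \<Rightarrow> 'a" and k :: nat
  assumes "Lqm_flow S d \<phi>"
  shows "of_nat k * entropy S d \<phi> \<le> entropy S d (\<phi> ^^ k)"
proof (cases "k = 0")
  case True
  then show ?thesis by simp
next
  case False
  interpret Lqm_flow S d \<phi> by (rule assms)
  have "of_nat k * local_entropy S d \<phi> x \<le> entropy S d (\<phi> ^^ k)" if "x \<in> inert S d \<phi>" for x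
  proof -
    have "of_nat k * local_entropy S d \<phi> x \<le> local_entropy S d (\<phi> ^^ k) (T x k)"
      using that False by (intro local_entropy_block) auto
    also have "\<dots> \<le> entropy S d (\<phi> ^^ k)"
      unfolding entropy_def using that False by (intro SUP_upper block_inert) auto
    finally show ?thesis .
  qed
  then show ?thesis
    unfolding entropy_def[of S d \<phi>] by (subst SUP_mult_left_ennreal) (rule SUP_least)
qed

end
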